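(* Let $g,n,N$ be positive integers, and let $\mathcal{C}$ be a modular $g$-Golomb ruler with $n$ marks modulo $N$. Write $$n=ag+r,\qquad 0\le r<g,$$ with $a,r$ integers. Then there is an ordinary $g$-Golomb ruler with $n$ marks and diameter at most $$N-\left\lceil \frac{N+\frac{g a(a-1)}2+ra}{n}\right\rceil.$$ The same bound is valid for every larger target multiplicity: for every integer $g'\ge g$ there is an ordinary $g'$-Golomb ruler with $n$ marks and diameter at most the same quantity (computed with the original $g,a,r$).
   Context: A finite set $\mathcal{G}\subset\mathbb{Z}$ is a (ordinary) $g$-Golomb ruler if for every positive integer $d$ the number of pairs $(a,c)\in \mathcal{G}^2$ with $c-a=d$ is at most $g$; its elements are called marks and its diameter is its largest element minus its smallest element. A set $\mathcal{A}$ of residues modulo $N$ is a modular $g$-Golomb ruler modulo $N$ if every nonzero residue modulo $N$ occurs at most $g$ times as a difference $a-a' \pmod N$ with $(a,a')$ an ordered pair of distinct elements of $\mathcal{A}$; its elements are called marks. *)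

theory Defs
  imports Complex_Main
begin

definition golomb_ruler :: "nat \<Rightarrow> int set \<Rightarrow> bool" where
  "golomb_ruler g G \<longleftrightarrow>
     finite G \<and> (\<forall>d>0. card {(a, c). a \<in> G \<and> c \<in> G \<and> c - a = d} \<le> g)"

definition diameter :: "int set \<Rightarrow> int" where
  "diameter G = Max G - Min G"

text \<open>
  Residues modulo \<open>N\<close> are represented by their canonical representatives in \<open>{0..<N}\<close>,
  so distinct elements of \<open>A\<close> are distinct residues and \<open>card A\<close> is the number of marks.
\<close>

definition modular_golomb_ruler :: "nat \<Rightarrow> nat \<Rightarrow> int set \<Rightarrow> bool" where
  "modular_golomb_ruler g N A \<longleftrightarrow>
     A \<subseteq> {0..<int N} \<and>
     (\<forall>d\<in>{1..<int N}.
        card {(a, a'). a \<in> A \<and> a' \<in> A \<and> a \<noteq> a' \<and> (a - a') mod int N = d} \<le> g)"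

end

theory Submission
  imports Defs
begin

text \<open>
  Unrolling \<open>C\<close> periodically and cutting it in the cyclic gap \<open>d\<close> between two consecutive marks
  yields an ordinary ruler of diameter \<open>N - d\<close>. The \<open>n\<close> cyclic gaps add up to \<open>N\<close>, and each value
  occurs at most \<open>g\<close> times among them. If \<open>M\<close> is the largest gap, the deficits \<open>M - d\<close> are thus
  nonnegative integers, each taken at most \<open>g\<close> times, so their sum \<open>n M - N\<close> is at least
  \<open>g (0 + 1 + \<dots> + (a - 1)) + r a\<close>.
\<close>

text \<open>Truncated subtraction gives \<open>a \<le> h i + (a - h i)\<close>, and the terms
  \<open>a - h i\<close> vanish unless \<open>h i\<close> is one of the values below
  \<open>a\<close>, each taken at most \<open>g\<close> times; hence they add up to at most
  \<open>g (1 + ... + a)\<close>. Everything is doubled to avoid division in \<open>nat\<close>. For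
  \<open>card I = a g + r\<close> the bound reads
  \<open>g a (a - 1) / 2 + r a \<le> (\<Sum>i\<in>I. h i)\<close>.\<close>

lemma sum_ge_of_bounded_multiplicity:
  fixes h :: "'a \<Rightarrow> nat"
  assumes "finite I" and mult: "\<And>v. card {i \<in> I. h i = v} \<le> g"
  shows "2 * a * card I \<le> 2 * (\<Sum>i\<in>I. h i) + g * (a * (a + 1))"
proof -
  define J where "J = {i \<in> I. h i < a}"
  have "finite J"
    using assms by (simp add: J_def)
  have "(\<Sum>i\<in>I. a - h i) = (\<Sum>i\<in>J. a - h i)"
    unfolding J_def using \<open>finite I\<close> by (intro sum.mono_neutral_right) auto
  also have "\<dots> = (\<Sum>v<a. \<Sum>i\<in>{i \<in> J. h i = v}. a - h i)"
    using \<open>finite J\<close> by (intro sum.group[symmetric]) (auto simp: J_def)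
  also have "\<dots> = (\<Sum>v<a. card {i \<in> J. h i = v} * (a - v))"
    by (intro sum.cong) auto
  also have "\<dots> \<le> (\<Sum>v<a. g * (a - v))"
  proof (intro sum_mono mult_right_mono)
    fix v
    have "card {i \<in> J. h i = v} \<le> card {i \<in> I. h i = v}"
      using \<open>finite I\<close> by (intro card_mono) (auto simp: J_def)
    then show "card {i \<in> J. h i = v} \<le> g"
      using mult[of v] by linarith
  qed auto
  also have "\<dots> = g * (\<Sum>v<a. a - v)"
    by (simp add: sum_distrib_left)
  finally have small: "(\<Sum>i\<in>I. a - h i) \<le> g * (\<Sum>v<a. a - v)" .
  have "2 * (\<Sum>v<a. a - v) = a * (a + 1)"
  proof (induction a)
    case (Suc a)
    have "(\<Sum>v<Suc a. Suc a - v) = Suc a + (\<Sum>v<a. a - v)"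
      by (subst sum.lessThan_Suc_shift) simp
    with Suc show ?case by simp
  qed simp
  then have "g * (a * (a + 1)) = 2 * (g * (\<Sum>v<a. a - v))"
    by (metis mult.left_commute)
  moreover have "a * card I \<le> (\<Sum>i\<in>I. h i + (a - h i))"
    using sum_mono[of I "\<lambda>_. a" "\<lambda>i. h i + (a - h i)"] by (simp add: mult.commute)
  ultimately show ?thesis
    using small unfolding sum.distrib by linarith
qed

lemma mod_eq_imp_eq:
  fixes x y N :: int
  assumes "x mod N = y mod N" and "\<bar>x - y\<bar> < N"
  shows "x = y"
proof -
  have "N dvd x - y"
    using assms(1) by (simp add: mod_eq_dvd_iff)
  then show ?thesis
    using assms(2) dvd_imp_le_int[of "x - y" N] by fastforce
qed

text \<open>Transfers the modular bound to pairs of integers: reduction modulo \<open>N\<close>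
  sends each pair of \<open>S\<close> to a pair of marks counted for the residue \<open>d\<close>,
  and no two pairs collide. It serves both for the gaps of the unrolled ruler and for the
  differences of the cut one.\<close>

lemma modular_golomb_ruler_card_le:
  assumes C: "modular_golomb_ruler g N C" and d: "0 < d" "d < int N"
    and S: "\<And>x y. (x, y) \<in> S \<Longrightarrow> x mod int N \<in> C \<and> y mod int N \<in> C \<and> y - x = d"
    and inj: "inj_on (\<lambda>(x, y). x mod int N) S"
  shows "card S \<le> g"
proof -
  let ?P = "{(b, b'). b \<in> C \<and> b' \<in> C \<and> b \<noteq> b' \<and> (b - b') mod int N = d}"
  let ?f = "\<lambda>(x, y). (y mod int N, x mod int N)"
  have "finite C"
    using C by (auto simp: modular_golomb_ruler_def intro: finite_subset)
  then have fin: "finite ?P"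
    by (auto intro: finite_subset[of _ "C \<times> C"])
  have "?f ` S \<subseteq> ?P"
  proof clarify
    fix x y assume xy: "(x, y) \<in> S"
    have "(y mod int N - x mod int N) mod int N = d"
      using S[OF xy] d by (simp add: mod_diff_eq)
    then show "y mod int N \<in> C \<and> x mod int N \<in> C \<and> y mod int N \<noteq> x mod int N \<and>
        (y mod int N - x mod int N) mod int N = d"
      using S[OF xy] d by auto
  qed
  moreover have "inj_on ?f S"
    using inj by (auto simp: inj_on_def)
  ultimately have "card S \<le> card ?P"
    using fin by (intro card_inj_on_le[of ?f])
  also have "\<dots> \<le> g"
    using C d by (auto simp: modular_golomb_ruler_def)
  finally show ?thesis .
qed

text \<open>A set of diameter below \<open>N\<close> embeds into the residues, so its differences
  below \<open>N\<close> inherit the modular bound, and larger ones do not occur.\<close>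

lemma golomb_ruler_of_modular:
  assumes C: "modular_golomb_ruler g N C" and "finite G"
    and sub: "\<And>x. x \<in> G \<Longrightarrow> x mod int N \<in> C"
    and close: "\<And>x y. x \<in> G \<Longrightarrow> y \<in> G \<Longrightarrow> \<bar>x - y\<bar> < int N"
  shows "golomb_ruler g G"
  unfolding golomb_ruler_def
proof (intro conjI allI impI)
  fix d :: int assume "d > 0"
  let ?S = "{(x, y). x \<in> G \<and> y \<in> G \<and> y - x = d}"
  show "card ?S \<le> g"
  proof (cases "d < int N")
    case True
    have "inj_on (\<lambda>x. x mod int N) G"
      by (rule inj_onI) (rule mod_eq_imp_eq[OF _ close])
    then have "inj_on (\<lambda>(x, y). x mod int N) ?S"
      by (auto simp: inj_on_def)
    then show ?thesis
      by (intro modular_golomb_ruler_card_le[OF C \<open>d > 0\<close> True]) (auto intro: sub)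
  next
    case False
    then have "(x, y) \<notin> ?S" for x y
      using close[of y x] by auto
    then have "?S = {}" by fast
    then show ?thesis by (simp only: card.empty le0)
  qed
qed fact

theorem lemma2:
  fixes g n N :: nat and C :: "int set" and a r :: int
  assumes "g > 0" and "n > 0" and "N > 0"
    and "modular_golomb_ruler g N C" and "card C = n"
    and "int n = a * int g + r" and "0 \<le> r" and "r < int g"
  defines "B \<equiv> int N -
      \<lceil>(real N + real g * real_of_int a * (real_of_int a - 1) / 2 + real_of_int r * real_of_int a)
         / real n\<rceil>"
  shows "(\<exists>G. golomb_ruler g G \<and> card G = n \<and> diameter G \<le> B) \<and>
         (\<forall>g'\<ge>g. \<exists>G. golomb_ruler g' G \<and> card G = n \<and> diameter G \<le> B)"
proof -
  note C = assms(4)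
  have CN: "C \<subseteq> {0..<int N}"
    using C by (simp add: modular_golomb_ruler_def)
  then have "finite C"
    by (auto intro: finite_subset)
  define L where "L = sorted_list_of_set C"
  have L: "length L = n" "set L = C" "sorted_wrt (<) L"
    using \<open>finite C\<close> \<open>card C = n\<close> by (auto simp: L_def)
  have LC: "L ! j \<in> C" if "j < n" for j
    using L that by (metis nth_mem)
  \<comment> \<open>The periodic unrolling: \<open>e\<close> runs through \<open>C\<close>, then
    \<open>C + N\<close>, \<open>C + 2N\<close> and so on.\<close>
  define e where "e j = L ! (j mod n) + int N * int (j div n)" for j
  have e_mod: "e j mod int N = L ! (j mod n)" for j
    using LC[of "j mod n"] CN \<open>n > 0\<close> by (auto simp: e_def)
  then have e_C: "e j mod int N \<in> C" for j
    using LC \<open>n > 0\<close> by simp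
  have e_shift: "e (j + n) = e j + int N" for j
    using \<open>n > 0\<close> by (simp add: e_def algebra_simps)
  have "strict_mono e"
  proof (unfold strict_mono_Suc_iff, intro allI)
    fix j
    show "e j < e (Suc j)"
    proof (cases "Suc (j mod n) = n")
      case True
      \<comment> \<open>At the end of a period the next mark is the first one shifted by
        \<open>N\<close>, which exceeds every residue.\<close>
      have "L ! (j mod n) < int N" "0 \<le> L ! 0"
        using LC[of "j mod n"] LC[of 0] CN \<open>n > 0\<close> by auto
      then show ?thesis
        using True by (simp add: e_def mod_Suc div_Suc algebra_simps)
    next
      case False
      then have "Suc (j mod n) < n"
        using \<open>n > 0\<close> by (simp add: Suc_lessI)
      then have "L ! (j mod n) < L ! Suc (j mod n)"
        using L by (simp add: sorted_wrt_nth_less)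
      then show ?thesis
        using False by (simp add: e_def mod_Suc div_Suc)
    qed
  qed
  note e_less = strict_monoD[OF this] and e_le = strict_mono_less_eq[OF this]
    and e_inj = strict_mono_imp_inj_on[OF this]

  define gap where "gap i = e (Suc i) - e i" for i
  have sum_gap: "(\<Sum>i<n. gap i) = int N"
    using e_shift[of 0] by (simp add: gap_def sum_lessThan_telescope)
  have gap_mult: "card {i \<in> {..<n}. gap i = v} \<le> g" for v
  \<comment> \<open>A single mark has the gap \<open>N\<close>, which is the residue 0 and escapes
    the modular condition; there \<open>g > 0\<close> suffices.\<close>
  proof (cases "n = 1")
    case True
    have "card {i \<in> {..<n}. gap i = v} \<le> card {..<n}"
      by (intro card_mono) auto
    then show ?thesis
      using True \<open>g > 0\<close> by simp
  next
    case False
    let ?J = "{i \<in> {..<n}. gap i = v}"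
    show ?thesis
    proof (cases "?J = {}")
      case False
      then obtain i where "gap i = v" by auto
      \<comment> \<open>With at least two marks, the next one comes strictly before the translate
        \<open>e i + N\<close>, so the gap is a nonzero residue.\<close>
      moreover have "e i < e (Suc i)" "e (Suc i) < e (i + n)"
        using \<open>n \<noteq> 1\<close> \<open>n > 0\<close> by (auto intro!: e_less)
      ultimately have v: "0 < v" "v < int N"
        using e_shift[of i] by (auto simp: gap_def)
      let ?f = "\<lambda>i. (e i, e (Suc i))"
      have "inj_on ?f ?J"
        using e_inj by (auto simp: inj_on_def)
      then have "card ?J = card (?f ` ?J)"
        by (simp add: card_image)
      also have "\<dots> \<le> g"
      proof (rule modular_golomb_ruler_card_le[OF C v])
        \<comment> \<open>Within one period these residues are the distinct entries
          \<open>L ! i\<close>.\<close>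
        have "inj_on (\<lambda>i. e i mod int N) ?J"
          using L(3) \<open>length L = n\<close>
          by (auto simp: inj_on_def e_mod strict_sorted_iff nth_eq_iff_index_eq)
        then show "inj_on (\<lambda>(x, y). x mod int N) (?f ` ?J)"
          by (auto simp: inj_on_def)
      qed (use e_C in \<open>auto simp: gap_def\<close>)
      finally show ?thesis .
    qed (simp only: card.empty le0)
  qed

  define M where "M = Max (gap ` {..<n})"
  have "M \<in> gap ` {..<n}"
    unfolding M_def using \<open>n > 0\<close> by (intro Max_in) auto
  then obtain m where m: "gap m = M" by auto
  have gap_le: "gap i \<le> M" if "i < n" for i
    unfolding M_def using that by (intro Max_ge) auto

  have "a \<ge> 0"
  proof (rule ccontr)
    \<comment> \<open>A negative \<open>a\<close> would force
      \<open>n \<le> r - g < 0\<close>.\<close>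
    assume "\<not> a \<ge> 0"
    then have "a * int g \<le> (-1) * int g"
      by (intro mult_right_mono) auto
    with assms show False by linarith
  qed
  \<comment> \<open>The deficits; \<open>nat\<close> loses nothing for \<open>i < n\<close>, since
    \<open>M\<close> is the largest gap there.\<close>
  define h where "h i = nat (M - gap i)" for i
  have "card {i \<in> {..<n}. h i = v} \<le> g" for v
  proof -
    have "{i \<in> {..<n}. h i = v} = {i \<in> {..<n}. gap i = M - int v}"
      using gap_le by (force simp: h_def)
    then show ?thesis
      using gap_mult by simp
  qed
  then have "2 * nat a * card {..<n} \<le> 2 * (\<Sum>i<n. h i) + g * (nat a * (nat a + 1))"
    by (intro sum_ge_of_bounded_multiplicity) auto
  then have "int (2 * nat a * n) \<le> int (2 * (\<Sum>i<n. h i) + g * (nat a * (nat a + 1)))"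
    by (simp only: card_lessThan of_nat_le_iff)
  then have "2 * a * int n \<le> 2 * (\<Sum>i<n. int (h i)) + int g * (a * (a + 1))"
    using \<open>a \<ge> 0\<close> by (simp add: distrib_left)
  also have "(\<Sum>i<n. int (h i)) = (\<Sum>i<n. M - gap i)"
    using gap_le by (intro sum.cong) (auto simp: h_def)
  also have "\<dots> = int n * M - int N"
    by (simp add: sum_subtractf sum_gap)
  \<comment> \<open>Substituting \<open>n = a g + r\<close> turns \<open>2 a n - g a (a + 1)\<close>
    into \<open>g a (a - 1) + 2 r a\<close>.\<close>
  finally have "2 * int N + int g * a * (a - 1) + 2 * r * a \<le> 2 * (int n * M)"
    unfolding \<open>int n = a * int g + r\<close> by (simp add: algebra_simps)
  then have "real_of_int (2 * int N + int g * a * (a - 1) + 2 * r * a)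
      \<le> real_of_int (2 * (int n * M))"
    by (simp only: of_int_le_iff)
  then have "(real N + real g * real_of_int a * (real_of_int a - 1) / 2
      + real_of_int r * real_of_int a) / real n \<le> real_of_int M"
    using \<open>n > 0\<close> by (simp add: divide_le_eq mult.commute)
  \<comment> \<open>As \<open>M\<close> is an integer, it also bounds the ceiling of the
    quotient.\<close>
  then have B: "int N - M \<le> B"
    by (simp add: B_def ceiling_le_iff)

  \<comment> \<open>The cut: \<open>n\<close> consecutive marks, from the right end of a largest gap
    to the left end of its translate by \<open>N\<close>, hence of diameter
    \<open>N - M\<close>.\<close>
  define G where "G = e ` {Suc m..m + n}"
  have G_bounds: "e (Suc m) \<le> x \<and> x \<le> e (m + n)" if "x \<in> G" for x
    using that by (auto simp: G_def e_le)
  have ends: "e (Suc m) \<in> G" "e (m + n) \<in> G"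
    using \<open>n > 0\<close> by (auto simp: G_def)
  have "finite G"
    by (simp add: G_def)
  have "card G = n"
    using e_inj by (simp add: G_def card_image inj_on_subset)
  have "Max G = e (m + n)" "Min G = e (Suc m)"
    using G_bounds ends \<open>finite G\<close> by (auto intro!: Max_eqI Min_eqI)
  then have diam: "diameter G \<le> B"
    using B m by (simp add: diameter_def gap_def e_shift)
  have "e (m + n) - e (Suc m) < int N"
    using e_less[of m "Suc m"] by (simp add: e_shift)
  then have "\<bar>x - y\<bar> < int N" if "x \<in> G" "y \<in> G" for x y
    using G_bounds[OF that(1)] G_bounds[OF that(2)] by linarith
  moreover have "x mod int N \<in> C" if "x \<in> G" for x
    using that e_C by (auto simp: G_def)
  ultimately have "golomb_ruler g G"
    using golomb_ruler_of_modular[OF C \<open>finite G\<close>] by blast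
  \<comment> \<open>The same ruler serves every larger multiplicity, which only relaxes the bound on
    each difference.\<close>
  then have "golomb_ruler g' G" if "g' \<ge> g" for g'
    using that by (auto simp: golomb_ruler_def intro: order_trans)
  then show ?thesis
    using \<open>card G = n\<close> diam by blast
qed

end
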